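(* Let $f:\mathbb{S}^J\to\mathbb{R}$ be a Kähler function of the form $f=\mathbf{J}^{\mathrm{Ad}(g)k(x)}$, where $g\in G^J(\mathbb{R})$ and $k(x)=\alpha x^2+\beta x+\gamma\in\mathfrak{a}$ ($\alpha,\beta,\gamma\in\mathbb{R}$). Then $$f(p)=\int_{-\infty}^{\infty}(\alpha x^2+\beta x+\gamma)\,\big[(\pi\circ\Phi_{g^{-1}})(p)\big](x)\,dx$$ for all $p\in\mathbb{S}^J$.
   Context: The Siegel-Jacobi space $\mathbb{S}^J$ is $\mathbb{H}\times\mathbb{C}$ ($\mathbb{H}$ the upper half-plane), with points $(\tau,z)$ and its Kähler-Berndt structure. Coordinates $(\theta_1,\theta_2,\dot\theta_1,\dot\theta_2)$ ($\theta_2<0$) are defined by $\tau=\dot\theta_2-i\theta_2$, $z=-\dot\theta_1+i\theta_1$, and $\eta_1=-\frac{\theta_1}{2\theta_2}$, $\eta_2=\frac{\theta_1^2-2\theta_2}{4\theta_2^2}$. $\pi:\mathbb{S}^J\to\mathcal{N}$ is the projection onto the space $\mathcal{N}$ of Gaussian densities on $\mathbb{R}$ coming from the identification $\mathbb{S}^J\cong T\mathcal{N}$: $\pi(p)$ is the Gaussian density with mean $\mu$ and deviation $\sigma$ determined by $\theta_1=\mu/\sigma^2$, $\theta_2=-1/(2\sigma^2)$. The Jacobi group $G^J(\mathbb{R})$ is $\mathrm{SL}(2,\mathbb{R})\times\mathbb{R}^2\times\mathbb{R}$ with multiplication $(M_1,X_1,\kappa_1)\cdot(M_2,X_2,\kappa_2)=(M_1M_2,X_1M_2+X_2,\kappa_1+\kappa_2+\Omega(X_1M_2,X_2))$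 (row vectors $X_i$; $\Omega(\xi,\eta)=\xi_1\eta_2-\xi_2\eta_1$). Its action on $\mathbb{S}^J$ is $\Phi_g(\tau,z)=\big(\frac{a\tau+b}{c\tau+d},\frac{z+\lambda\tau+\mu}{c\tau+d}\big)$ for $g=\big(\big[\begin{smallmatrix}a&b\\c&d\end{smallmatrix}\big],(\lambda,\mu,\kappa)\big)$. Its Lie algebra is $\mathfrak{g}^J=\mathfrak{sl}(2,\mathbb{R})\times\mathbb{R}^2\times\mathbb{R}$, with adjoint representation $\mathrm{Ad}$ and basis $F=\big[\begin{smallmatrix}0&1\\0&0\end{smallmatrix}\big]$, $G=\big[\begin{smallmatrix}0&0\\1&0\end{smallmatrix}\big]$, $H=\big[\begin{smallmatrix}1&0\\0&-1\end{smallmatrix}\big]$ in $\mathfrak{sl}(2,\mathbb{R})$, $P=(1,0,0)$, $Q=(0,1,0)$, $R=(0,0,1)$ in $\mathbb{R}^2\times\mathbb{R}$. The momentum map $\mathbf{J}:\mathbb{S}^J\to(\mathfrak{g}^J)^*$, with $\mathbf{J}^L(p)=\mathbf{J}(p)(L)$, is determined by linearity in $L$ and $\mathbf{J}^F=-\eta_2$, $\mathbf{J}^G=\frac14\dot\theta_1^2+\eta_2\dot\theta_2^2+\eta_1\dot\theta_1\dot\theta_2-\frac{1}{4(\eta_1^2-\eta_2)}$, $\mathbf{J}^H=-\eta_1\dot\theta_1-2\eta_2\dot\theta_2$, $\mathbf{J}^P=\frac12\dot\theta_1+\eta_1\dot\theta_2$, $\mathbf{J}^Q=\eta_1$, $\mathbf{J}^R=-\frac14$;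 the Kähler functions on $\mathbb{S}^J$ are exactly the functions $\mathbf{J}^L$, $L\in\mathfrak{g}^J$. $\mathfrak{a}=\mathrm{Vect}_{\mathbb{R}}\{F,Q,R\}\subset\mathfrak{g}^J$ is identified with the space of real polynomials in $x$ of degree $\le2$ via $F\mapsto-x^2$, $Q\mapsto x$, $R\mapsto-\frac14$; thus $k(x)=\alpha x^2+\beta x+\gamma$ stands for $-\alpha F+\beta Q-4\gamma R$. *)

theory Defs
  imports "HOL-Probability.Probability" "HOL-Algebra.Group"
    "HOL-Computational_Algebra.Polynomial"
begin

section \<open>The Jacobi group and its Lie algebra\<close>

text \<open>
  Both the group and its Lie algebra are subsets of the ambient vector space
  of triples (M, X, \<kappa>) of a real 2 by 2 matrix, a row vector and a real number.
  Row vectors act on matrices from the left, which is the library's operation \<open>v*\<close>.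
\<close>

type_synonym jacobi_ambient = "(real^2^2) \<times> (real^2) \<times> real"

definition symp_form :: "real^2 \<Rightarrow> real^2 \<Rightarrow> real" where
  "symp_form \<xi> \<eta> = \<xi> $ 1 * \<eta> $ 2 - \<xi> $ 2 * \<eta> $ 1"

fun jacobi_mult :: "jacobi_ambient \<Rightarrow> jacobi_ambient \<Rightarrow> jacobi_ambient" where
  "jacobi_mult (M1, X1, \<kappa>1) (M2, X2, \<kappa>2) =
     (M1 ** M2, X1 v* M2 + X2, \<kappa>1 + \<kappa>2 + symp_form (X1 v* M2) X2)"

definition jacobi_group :: "jacobi_ambient monoid" where
  "jacobi_group =
     \<lparr>carrier = {(M, X, \<kappa>). det M = 1}, mult = jacobi_mult, one = (mat 1, 0, 0)\<rparr>"

definition jacobi_algebra :: "jacobi_ambient set" where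
  "jacobi_algebra = {(A, X, r). trace A = 0}"

text \<open>
  Ad(g) is the differential at the identity of the conjugation by g. Since the
  multiplication is given by a polynomial formula on the whole ambient space, this differential
  is the restriction to the Lie algebra (the tangent space of the group at the identity) of the
  derivative of the ambient conjugation map; see \<open>Ad_curve\<close> below.
\<close>

definition Ad :: "jacobi_ambient \<Rightarrow> jacobi_ambient \<Rightarrow> jacobi_ambient" where
  "Ad g L = frechet_derivative
     (\<lambda>h. g \<otimes>\<^bsub>jacobi_group\<^esub> h \<otimes>\<^bsub>jacobi_group\<^esub> inv\<^bsub>jacobi_group\<^esub> g)
     (at \<one>\<^bsub>jacobi_group\<^esub>) L"

definition elt_F :: jacobi_ambient where
  "elt_F = (vector [vector [0, 1], vector [0, 0]], 0, 0)"
definition elt_G :: jacobi_ambient where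
  "elt_G = (vector [vector [0, 0], vector [1, 0]], 0, 0)"
definition elt_H :: jacobi_ambient where
  "elt_H = (vector [vector [1, 0], vector [0, -1]], 0, 0)"
definition elt_P :: jacobi_ambient where
  "elt_P = (0, vector [1, 0], 0)"
definition elt_Q :: jacobi_ambient where
  "elt_Q = (0, vector [0, 1], 0)"
definition elt_R :: jacobi_ambient where
  "elt_R = (0, 0, 1)"

text \<open>
  The identification of the real polynomials of degree at most 2 with the
  span of F, Q, R, where F, Q, R correspond to the polynomials -x^2, x, -1/4.
\<close>

definition of_quadratic :: "real poly \<Rightarrow> jacobi_ambient" where
  "of_quadratic k =
     - coeff k 2 *\<^sub>R elt_F + coeff k 1 *\<^sub>R elt_Q - (4 * coeff k 0) *\<^sub>R elt_R"


section \<open>The Siegel-Jacobi space\<close>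

definition siegel_jacobi :: "(complex \<times> complex) set" where
  "siegel_jacobi = {(\<tau>, z). 0 < Im \<tau>}"

fun jacobi_action :: "jacobi_ambient \<Rightarrow> complex \<times> complex \<Rightarrow> complex \<times> complex" where
  "jacobi_action (M, X, \<kappa>) (\<tau>, z) =
     (let a = of_real (M $ 1 $ 1); b = of_real (M $ 1 $ 2);
          c = of_real (M $ 2 $ 1); d = of_real (M $ 2 $ 2);
          l = of_real (X $ 1); m = of_real (X $ 2)
      in ((a * \<tau> + b) / (c * \<tau> + d), (z + l * \<tau> + m) / (c * \<tau> + d)))"

text \<open>
  The coordinates are read off from \<tau> = \<theta>2' - i \<theta>2 and z = -\<theta>1' + i \<theta>1, the prime
  standing for a dot.
\<close>

definition theta1 :: "complex \<times> complex \<Rightarrow> real" where "theta1 p = Im (snd p)"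
definition theta2 :: "complex \<times> complex \<Rightarrow> real" where "theta2 p = - Im (fst p)"
definition dtheta1 :: "complex \<times> complex \<Rightarrow> real" where "dtheta1 p = - Re (snd p)"
definition dtheta2 :: "complex \<times> complex \<Rightarrow> real" where "dtheta2 p = Re (fst p)"

definition eta1 :: "complex \<times> complex \<Rightarrow> real" where
  "eta1 p = - theta1 p / (2 * theta2 p)"
definition eta2 :: "complex \<times> complex \<Rightarrow> real" where
  "eta2 p = ((theta1 p)\<^sup>2 - 2 * theta2 p) / (4 * (theta2 p)\<^sup>2)"

text \<open>The projection onto the Gaussian densities, which are regarded as functions on the reals.\<close>

definition gaussian_proj :: "complex \<times> complex \<Rightarrow> real \<Rightarrow> real" where
  "gaussian_proj p =
     (case THE (\<mu>, \<sigma>). 0 < \<sigma> \<and> theta1 p = \<mu> / \<sigma>\<^sup>2 \<and> theta2 p = - 1 / (2 * \<sigma>\<^sup>2)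
      of (\<mu>, \<sigma>) \<Rightarrow> normal_density \<mu> \<sigma>)"


section \<open>The momentum map and Kaehler functions\<close>

definition momentum_F :: "complex \<times> complex \<Rightarrow> real" where
  "momentum_F p = - eta2 p"
definition momentum_G :: "complex \<times> complex \<Rightarrow> real" where
  "momentum_G p = 1/4 * (dtheta1 p)\<^sup>2 + eta2 p * (dtheta2 p)\<^sup>2
     + eta1 p * dtheta1 p * dtheta2 p - 1 / (4 * ((eta1 p)\<^sup>2 - eta2 p))"
definition momentum_H :: "complex \<times> complex \<Rightarrow> real" where
  "momentum_H p = - eta1 p * dtheta1 p - 2 * eta2 p * dtheta2 p"
definition momentum_P :: "complex \<times> complex \<Rightarrow> real" where
  "momentum_P p = 1/2 * dtheta1 p + eta1 p * dtheta2 p"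
definition momentum_Q :: "complex \<times> complex \<Rightarrow> real" where
  "momentum_Q p = eta1 p"
definition momentum_R :: "complex \<times> complex \<Rightarrow> real" where
  "momentum_R p = - 1/4"

text \<open>
  \<open>momentum L p\<close> is the value at p of the component of the momentum map along L. On the Lie
  algebra the coefficients of L in the basis F, G, H, P, Q, R are the entries used here; see
  \<open>jacobi_algebra_basis\<close> below.
\<close>

fun momentum :: "jacobi_ambient \<Rightarrow> complex \<times> complex \<Rightarrow> real" where
  "momentum (A, X, r) p =
     A $ 1 $ 2 * momentum_F p + A $ 2 $ 1 * momentum_G p + A $ 1 $ 1 * momentum_H p
     + X $ 1 * momentum_P p + X $ 2 * momentum_Q p + r * momentum_R p"

text \<open>
  By the classification of the Kaehler functions of the Kaehler-Berndt structure, these are exactly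
  the components of the momentum map.
\<close>

definition kaehler_function :: "(complex \<times> complex \<Rightarrow> real) \<Rightarrow> bool" where
  "kaehler_function f \<longleftrightarrow> (\<exists>L\<in>jacobi_algebra. \<forall>p\<in>siegel_jacobi. f p = momentum L p)"


section \<open>Consistency of the definitions\<close>

lemma jacobi_mult_alt:
  "jacobi_mult p q = (fst p ** fst q, fst (snd p) v* fst q + fst (snd q),
     snd (snd p) + snd (snd q) + symp_form (fst (snd p) v* fst q) (fst (snd q)))"
  by (cases p; cases q) simp

lemma symp_form_matrix: "symp_form (X v* M) (Y v* M) = det M * symp_form X Y"
  by (simp add: symp_form_def vector_matrix_mult_def sum_2 det_2 algebra_simps)

lemma symp_form_add:
  "symp_form (X + Y) Z = symp_form X Z + symp_form Y Z"
  "symp_form X (Y + Z) = symp_form X Y + symp_form X Z"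
  by (simp_all add: symp_form_def algebra_simps)

lemma group_jacobi_group: "group jacobi_group"
proof (rule groupI)
  fix x y assume "x \<in> carrier jacobi_group" "y \<in> carrier jacobi_group"
  then show "x \<otimes>\<^bsub>jacobi_group\<^esub> y \<in> carrier jacobi_group"
    by (auto simp: jacobi_group_def det_mul)
next
  show "\<one>\<^bsub>jacobi_group\<^esub> \<in> carrier jacobi_group" by (simp add: jacobi_group_def)
next
  fix x y z
  assume "x \<in> carrier jacobi_group" "y \<in> carrier jacobi_group" "z \<in> carrier jacobi_group"
  then obtain M1 X1 r1 M2 X2 r2 M3 X3 r3
    where *: "x = (M1, X1, r1)" "y = (M2, X2, r2)" "z = (M3, X3, r3)" "det M3 = 1"
    by (cases x; cases y; cases z) (auto simp: jacobi_group_def)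
  show "x \<otimes>\<^bsub>jacobi_group\<^esub> y \<otimes>\<^bsub>jacobi_group\<^esub> z
      = x \<otimes>\<^bsub>jacobi_group\<^esub> (y \<otimes>\<^bsub>jacobi_group\<^esub> z)"
    using symp_form_matrix[of "X1 v* M2" M3 X2] *(4)
    by (simp add: *(1-3) jacobi_group_def matrix_mul_assoc vector_matrix_left_distrib
        symp_form_add flip: vector_matrix_mul_assoc)
next
  fix x assume "x \<in> carrier jacobi_group"
  then show "\<one>\<^bsub>jacobi_group\<^esub> \<otimes>\<^bsub>jacobi_group\<^esub> x = x"
    by (auto simp: jacobi_group_def symp_form_def vector_matrix_mult_def zero_vec_def)
next
  fix x assume x: "x \<in> carrier jacobi_group"
  obtain M X \<kappa> where x': "x = (M, X, \<kappa>)" by (cases x)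
  have d: "det M = 1" using x x' by (simp add: jacobi_group_def)
  then have "invertible M" by (simp add: invertible_det_nz)
  then obtain N where N: "N ** M = mat 1" "M ** N = mat 1" by (auto simp: invertible_def)
  have "det N * det M = 1" using N by (metis det_I det_mul)
  then have "det N = 1" using d by simp
  then show "\<exists>y\<in>carrier jacobi_group. y \<otimes>\<^bsub>jacobi_group\<^esub> x = \<one>\<^bsub>jacobi_group\<^esub>"
    using x' N
    by (intro bexI[of _ "(N, - X v* N, - \<kappa>)"])
       (auto simp: jacobi_group_def vector_matrix_mul_assoc symp_form_def)
qed

lemma jacobi_algebra_basis:
  assumes "(A, X, r) \<in> jacobi_algebra"
  shows "(A, X, r) = A $ 1 $ 2 *\<^sub>R elt_F + A $ 2 $ 1 *\<^sub>R elt_G + A $ 1 $ 1 *\<^sub>R elt_H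
    + X $ 1 *\<^sub>R elt_P + X $ 2 *\<^sub>R elt_Q + r *\<^sub>R elt_R"
  using assms
  by (simp add: jacobi_algebra_def trace_def sum_2 elt_F_def elt_G_def elt_H_def elt_P_def
      elt_Q_def elt_R_def vec_eq_iff forall_2)

lemma linear_momentum: "linear (\<lambda>L. momentum L p)"
  by (rule linearI) (auto simp: algebra_simps)

lemma gaussian_proj_eq:
  assumes "0 < \<sigma>" "theta1 p = \<mu> / \<sigma>\<^sup>2" "theta2 p = - 1 / (2 * \<sigma>\<^sup>2)"
  shows "gaussian_proj p = normal_density \<mu> \<sigma>"
proof -
  have "(THE (\<mu>, \<sigma>). 0 < \<sigma> \<and> theta1 p = \<mu> / \<sigma>\<^sup>2 \<and> theta2 p = - 1 / (2 * \<sigma>\<^sup>2)) = (\<mu>, \<sigma>)"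
  proof (rule the_equality, goal_cases)
    case 1
    then show ?case using assms by simp
  next
    case (2 q)
    obtain m s where q: "q = (m, s)" by (cases q)
    with 2 have s: "0 < s" "theta1 p = m / s\<^sup>2" "theta2 p = - 1 / (2 * s\<^sup>2)" by auto
    have "s\<^sup>2 = \<sigma>\<^sup>2" using s assms by (simp add: field_simps)
    then have "s = \<sigma>" using s(1) assms(1) by (simp add: power2_eq_iff_nonneg)
    moreover have "m = \<mu>" using s assms \<open>s = \<sigma>\<close> by simp
    ultimately show ?case using q by simp
  qed
  then show ?thesis by (simp add: gaussian_proj_def)
qed

lemma gaussian_proj_exists:
  assumes "p \<in> siegel_jacobi"
  obtains \<mu> \<sigma> where "0 < \<sigma>" "theta1 p = \<mu> / \<sigma>\<^sup>2" "theta2 p = - 1 / (2 * \<sigma>\<^sup>2)"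
proof
  have "Im (fst p) > 0" using assms by (auto simp: siegel_jacobi_def)
  then show "0 < sqrt (1 / (2 * Im (fst p)))"
    "theta1 p = (theta1 p * (sqrt (1 / (2 * Im (fst p))))\<^sup>2) / (sqrt (1 / (2 * Im (fst p))))\<^sup>2"
    "theta2 p = - 1 / (2 * (sqrt (1 / (2 * Im (fst p))))\<^sup>2)"
    by (auto simp: theta2_def)
qed

lemma bounded_bilinear_matrix_mult: "bounded_bilinear ((**) :: real^2^2 \<Rightarrow> real^2^2 \<Rightarrow> real^2^2)"
  unfolding bilinear_conv_bounded_bilinear[symmetric] bilinear_def
  by (auto intro!: linearI simp: vec_eq_iff matrix_matrix_mult_def sum_2 forall_2 algebra_simps)

lemma bounded_bilinear_vector_matrix: "bounded_bilinear ((v*) :: real^2 \<Rightarrow> real^2^2 \<Rightarrow> real^2)"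
  unfolding bilinear_conv_bounded_bilinear[symmetric] bilinear_def
  by (auto intro!: linearI simp: vec_eq_iff vector_matrix_mult_def sum_2 forall_2 algebra_simps)

lemma bounded_bilinear_symp_form: "bounded_bilinear symp_form"
  unfolding bilinear_conv_bounded_bilinear[symmetric] bilinear_def
  by (auto intro!: linearI simp: symp_form_def algebra_simps)

lemmas jacobi_has_derivative =
  bounded_bilinear.FDERIV[OF bounded_bilinear_matrix_mult]
  bounded_bilinear.FDERIV[OF bounded_bilinear_vector_matrix]
  bounded_bilinear.FDERIV[OF bounded_bilinear_symp_form]

lemma conj_differentiable:
  "(\<lambda>h. g \<otimes>\<^bsub>jacobi_group\<^esub> h \<otimes>\<^bsub>jacobi_group\<^esub> g') differentiable (at x)"
  unfolding jacobi_group_def monoid.simps jacobi_mult_alt fst_conv snd_conv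
  unfolding differentiable_def
  by (rule exI) (rule derivative_eq_intros jacobi_has_derivative refl)+

lemma Ad_has_derivative:
  "((\<lambda>h. g \<otimes>\<^bsub>jacobi_group\<^esub> h \<otimes>\<^bsub>jacobi_group\<^esub> inv\<^bsub>jacobi_group\<^esub> g) has_derivative Ad g)
     (at \<one>\<^bsub>jacobi_group\<^esub>)"
  using conj_differentiable frechet_derivative_works unfolding Ad_def by blast

lemma Ad_curve:
  assumes "(c has_vector_derivative L) (at 0)" "c 0 = \<one>\<^bsub>jacobi_group\<^esub>"
  shows "((\<lambda>t. g \<otimes>\<^bsub>jacobi_group\<^esub> c t \<otimes>\<^bsub>jacobi_group\<^esub> inv\<^bsub>jacobi_group\<^esub> g)
    has_vector_derivative Ad g L) (at 0)"
proof -
  have "(c has_derivative (\<lambda>t. t *\<^sub>R L)) (at 0)"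
    using assms(1) by (simp add: has_vector_derivative_def)
  from has_derivative_compose[OF this, of _ "Ad g"] Ad_has_derivative[of g] assms(2)
  have "((\<lambda>t. g \<otimes>\<^bsub>jacobi_group\<^esub> c t \<otimes>\<^bsub>jacobi_group\<^esub> inv\<^bsub>jacobi_group\<^esub> g)
    has_derivative (\<lambda>t. Ad g (t *\<^sub>R L))) (at 0)"
    by simp
  moreover have "linear (Ad g)" using Ad_has_derivative has_derivative_linear by blast
  ultimately show ?thesis
    by (simp add: has_vector_derivative_def linear_cmul)
qed

lemma of_quadratic_image:
  "of_quadratic ` {k. degree k \<le> 2} = span {elt_F, elt_Q, elt_R}"
proof (intro equalityI subsetI)
  fix v assume "v \<in> of_quadratic ` {k. degree k \<le> 2}"
  then show "v \<in> span {elt_F, elt_Q, elt_R}"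
    unfolding of_quadratic_def
    by (elim imageE, hypsubst, intro span_add span_diff span_scale span_base) auto
next
  fix v assume "v \<in> span {elt_F, elt_Q, elt_R}"
  then obtain a b c where v: "v = a *\<^sub>R elt_F + b *\<^sub>R elt_Q + c *\<^sub>R elt_R"
    by (auto simp: span_insert span_singleton algebra_simps)
  have "v = of_quadratic [:- c / 4, b, - a:]"
    by (simp add: v of_quadratic_def numeral_2_eq_2)
  moreover have "degree [:- c / 4, b, - a:] \<le> 2"
    by (simp add: numeral_2_eq_2)
  ultimately show "v \<in> of_quadratic ` {k. degree k \<le> 2}" by blast
qed

lemma Ad_in_jacobi_algebra:
  assumes g: "g \<in> carrier jacobi_group" and L: "L \<in> jacobi_algebra"
  shows "Ad g L \<in> jacobi_algebra"
proof -
  interpret group jacobi_group by (rule group_jacobi_group)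
  define N where "N = fst (inv\<^bsub>jacobi_group\<^esub> g)"
  have "fst (inv\<^bsub>jacobi_group\<^esub> g \<otimes>\<^bsub>jacobi_group\<^esub> g) = fst \<one>\<^bsub>jacobi_group\<^esub>"
    using g by simp
  then have N: "N ** fst g = mat 1"
    by (simp add: N_def jacobi_group_def jacobi_mult_alt)
  have "((\<lambda>h. fst g ** fst h ** N) has_derivative (\<lambda>h. fst (Ad g h)))
      (at \<one>\<^bsub>jacobi_group\<^esub>)"
    using has_derivative_fst[OF Ad_has_derivative[of g]]
    by (simp add: N_def jacobi_group_def jacobi_mult_alt)
  moreover have "((\<lambda>h. fst g ** fst h ** N) has_derivative (\<lambda>h. fst g ** fst h ** N))
      (at \<one>\<^bsub>jacobi_group\<^esub>)"
    by (auto intro!: linear_imp_has_derivative linearI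
        simp: vec_eq_iff matrix_matrix_mult_def sum_2 forall_2 algebra_simps)
  ultimately have "fst (Ad g L) = fst g ** fst L ** N"
    using has_derivative_unique by metis
  then have "trace (fst (Ad g L)) = trace (fst L ** (N ** fst g))"
    by (metis matrix_mul_assoc trace_mul_sym)
  then show ?thesis
    using L N by (auto simp: jacobi_algebra_def split_beta)
qed

text \<open>Hence every function of the form considered in the theorem is a Kaehler function.\<close>

lemma kaehler_function_momentum_Ad:
  assumes "g \<in> carrier jacobi_group"
  shows "kaehler_function (momentum (Ad g (of_quadratic k)))"
proof -
  have "of_quadratic k \<in> jacobi_algebra"
    by (simp add: of_quadratic_def jacobi_algebra_def elt_F_def elt_Q_def elt_R_def trace_def sum_2)
  then show ?thesis
    using Ad_in_jacobi_algebra[OF assms] unfolding kaehler_function_def by blast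
qed

end

theory Submission
  imports Defs
begin

text \<open>
  The momentum map is equivariant, so the value at p of the component along Ad(g) k is the value of
  the component along k at q, the image of p under the inverse of g. For k in the span of F, Q, R
  that component is \<alpha> \<eta>2 + \<beta> \<eta>1 + \<gamma>, and \<eta>1, \<eta>2 are the first two moments of the Gaussian
  density attached to q.
\<close>

lemma has_bochner_integral_normal_quadratic:
  assumes "0 < \<sigma>"
  shows "has_bochner_integral lborel
    (\<lambda>x. (\<alpha> * x\<^sup>2 + \<beta> * x + \<gamma>) * normal_density \<mu> \<sigma> x) (\<alpha> * (\<mu>\<^sup>2 + \<sigma>\<^sup>2) + \<beta> * \<mu> + \<gamma>)"
proof -
  have 0: "has_bochner_integral lborel (normal_density \<mu> \<sigma>) 1"
    using normal_moment_even[OF assms, of \<mu> 0] by simp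
  have 1: "has_bochner_integral lborel (\<lambda>x. normal_density \<mu> \<sigma> x * (x - \<mu>)) 0"
    using normal_moment_odd[OF assms, of \<mu> 0] by simp
  have 2: "has_bochner_integral lborel (\<lambda>x. normal_density \<mu> \<sigma> x * (x - \<mu>)\<^sup>2) (\<sigma>\<^sup>2)"
    using normal_moment_even[OF assms, of \<mu> 1] by (simp add: fact_2)
  \<comment> \<open>The coefficients are those of the quadratic expanded in powers of
    \<open>x - \<mu>\<close>, so only the central moments \<sigma>^2, 0 and 1 enter.\<close>
  have "has_bochner_integral lborel
      (\<lambda>x. \<alpha> * (normal_density \<mu> \<sigma> x * (x - \<mu>)\<^sup>2)
        + (2 * \<alpha> * \<mu> + \<beta>) * (normal_density \<mu> \<sigma> x * (x - \<mu>))
        + (\<alpha> * \<mu>\<^sup>2 + \<beta> * \<mu> + \<gamma>) * normal_density \<mu> \<sigma> x)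
      (\<alpha> * \<sigma>\<^sup>2 + (2 * \<alpha> * \<mu> + \<beta>) * 0 + (\<alpha> * \<mu>\<^sup>2 + \<beta> * \<mu> + \<gamma>) * 1)"
    by (intro has_bochner_integral_add has_bochner_integral_mult_right 0 1 2)
  then show ?thesis
    by (simp add: algebra_simps power2_eq_square)
qed

lemma has_bochner_integral_gaussian_proj:
  assumes "p \<in> siegel_jacobi"
  shows "has_bochner_integral lborel
    (\<lambda>x. (\<alpha> * x\<^sup>2 + \<beta> * x + \<gamma>) * gaussian_proj p x) (\<alpha> * eta2 p + \<beta> * eta1 p + \<gamma>)"
proof -
  obtain \<mu> \<sigma> where *: "0 < \<sigma>" "theta1 p = \<mu> / \<sigma>\<^sup>2" "theta2 p = - 1 / (2 * \<sigma>\<^sup>2)"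
    using gaussian_proj_exists[OF assms] .
  have "eta1 p = \<mu>" "eta2 p = \<mu>\<^sup>2 + \<sigma>\<^sup>2"
    using *(1) by (simp_all add: eta1_def eta2_def *(2,3) field_simps power2_eq_square)
  then show ?thesis
    using has_bochner_integral_normal_quadratic[OF *(1)] gaussian_proj_eq[OF *] by simp
qed

text \<open>The factors -1 and -4 in \<open>of_quadratic\<close> cancel those in J^F = -\<eta>2 and
  J^R = -1/4.\<close>

lemma momentum_of_quadratic:
  "momentum (of_quadratic [:\<gamma>, \<beta>, \<alpha>:]) p = \<alpha> * eta2 p + \<beta> * eta1 p + \<gamma>"
  by (simp add: of_quadratic_def elt_F_def elt_Q_def elt_R_def momentum_F_def momentum_Q_def
      momentum_R_def numeral_2_eq_2)

text \<open>The adjugate matrix, which inverts \<open>M\<close> when \<open>det M = 1\<close>; its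
  entries are linear in those of \<open>M\<close>, which keeps later computations free of
  division.\<close>

definition sl2_inv :: "real^2^2 \<Rightarrow> real^2^2" where
  "sl2_inv M = vector [vector [M $ 2 $ 2, - M $ 1 $ 2], vector [- M $ 2 $ 1, M $ 1 $ 1]]"

text \<open>In the product of the claimed inverse with the element, the form is evaluated at (-X, X)
  and vanishes, so the central coordinate just changes sign.\<close>

lemma inv_jacobi_group:
  assumes "(M, X, \<kappa>) \<in> carrier jacobi_group"
  shows "inv\<^bsub>jacobi_group\<^esub> (M, X, \<kappa>) = (sl2_inv M, - X v* sl2_inv M, - \<kappa>)"
proof -
  interpret group jacobi_group by (rule group_jacobi_group)
  have "M $ 1 $ 1 * M $ 2 $ 2 - M $ 1 $ 2 * M $ 2 $ 1 = 1"
    using assms by (simp add: jacobi_group_def det_2)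
  then have N: "sl2_inv M ** M = mat 1" "det (sl2_inv M) = 1"
    by (simp_all add: sl2_inv_def vec_eq_iff forall_2 matrix_matrix_mult_def sum_2 mat_def det_2
        algebra_simps)
  show ?thesis
    using assms N
    by (intro inv_equality)
      (auto simp: jacobi_group_def vector_matrix_mul_assoc symp_form_def)
qed

text \<open>Obtained by the product rule at the identity. Left multiplication contributes one
  \<open>symp_form X Y\<close>; right multiplication by the inverse contributes
  \<open>symp_form X (X v* A + Y)\<close>, hence the factor 2 and the quadratic term in
  \<open>X\<close>.\<close>

lemma Ad_eq:
  assumes "(M, X, \<kappa>) \<in> carrier jacobi_group"
  shows "Ad (M, X, \<kappa>) (A, Y, r) =
    (M ** A ** sl2_inv M, (X v* A + Y) v* sl2_inv M, r + 2 * symp_form X Y + symp_form X (X v* A))"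
proof -
  have d: "det (sl2_inv M) = 1"
    using assms by (simp add: jacobi_group_def det_2 sl2_inv_def algebra_simps)
  have D: "((\<lambda>h. (M, X, \<kappa>) \<otimes>\<^bsub>jacobi_group\<^esub> h
        \<otimes>\<^bsub>jacobi_group\<^esub> (sl2_inv M, - X v* sl2_inv M, - \<kappa>))
      has_derivative (\<lambda>h. (M ** fst h ** sl2_inv M,
        (X v* fst h + fst (snd h)) v* sl2_inv M,
        snd (snd h) + symp_form X (fst (snd h))
          + symp_form ((X v* fst h + fst (snd h)) v* sl2_inv M) (- X v* sl2_inv M))))
      (at (mat 1, 0, 0))"
    unfolding jacobi_group_def monoid.simps jacobi_mult_alt fst_conv snd_conv
    by (rule derivative_eq_intros jacobi_has_derivative refl)+
      (auto simp: fun_eq_iff symp_form_def vector_matrix_mult_def matrix_matrix_mult_def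
        vec_eq_iff forall_2 sum_2 mat_def)
  have one: "\<one>\<^bsub>jacobi_group\<^esub> = (mat 1, 0, 0)"
    by (simp add: jacobi_group_def)
  have "Ad (M, X, \<kappa>) = (\<lambda>h. (M ** fst h ** sl2_inv M,
        (X v* fst h + fst (snd h)) v* sl2_inv M,
        snd (snd h) + symp_form X (fst (snd h))
          + symp_form ((X v* fst h + fst (snd h)) v* sl2_inv M) (- X v* sl2_inv M)))"
    unfolding Ad_def inv_jacobi_group[OF assms] one by (rule frechet_derivative_at[OF D, symmetric])
  \<comment> \<open>\<open>symp_form\<close> is invariant under \<open>sl2_inv M\<close>, which has
    determinant 1, and the sign of \<open>- X\<close> is absorbed by antisymmetry.\<close>
  then show ?thesis
    by (simp add: symp_form_matrix d) (simp add: symp_form_def algebra_simps)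
qed

lemma theta_jacobi_action:
  fixes \<tau> z :: complex
  assumes "det M = 1"
  defines "w \<equiv> complex_of_real (M $ 2 $ 1) * \<tau> + complex_of_real (M $ 2 $ 2)"
  shows "theta2 (jacobi_action (M, X, \<kappa>) (\<tau>, z)) = - (Im \<tau>) / (cmod w)\<^sup>2"
    and "theta1 (jacobi_action (M, X, \<kappa>) (\<tau>, z)) =
      Im ((z + of_real (X $ 1) * \<tau> + of_real (X $ 2)) * cnj w) / (cmod w)\<^sup>2"
proof -
  \<comment> \<open>Making the denominator real reduces both coordinates to imaginary parts of
    products with \<open>cnj w\<close>.\<close>
  have *: "Im (u / w) = Im (u * cnj w) / (cmod w)\<^sup>2" for u
    by (subst complex_div_cnj) (simp only: of_real_power[symmetric] Im_divide_of_real)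
  have "Im ((of_real (M $ 1 $ 1) * \<tau> + of_real (M $ 1 $ 2)) * cnj w) = det M * Im \<tau>"
    by (simp add: w_def det_2 algebra_simps)
  then show "theta2 (jacobi_action (M, X, \<kappa>) (\<tau>, z)) = - (Im \<tau>) / (cmod w)\<^sup>2"
    using assms(1) by (simp add: theta2_def Let_def * flip: w_def)
  show "theta1 (jacobi_action (M, X, \<kappa>) (\<tau>, z)) =
      Im ((z + of_real (X $ 1) * \<tau> + of_real (X $ 2)) * cnj w) / (cmod w)\<^sup>2"
    by (simp add: theta1_def Let_def * flip: w_def)
qed

text \<open>The factor |w|^2 cancels in -\<theta>1 / (2 \<theta>2), and \<eta>2 = \<eta>1^2 - 1 / (2
  \<theta>2) turns it into a numerator.\<close>

lemma eta_jacobi_action: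
  fixes \<tau> z :: complex and X :: "real^2"
  assumes "det M = 1" "0 < Im \<tau>"
  defines "w \<equiv> complex_of_real (M $ 2 $ 1) * \<tau> + complex_of_real (M $ 2 $ 2)"
    and "u \<equiv> z + of_real (X $ 1) * \<tau> + of_real (X $ 2)"
  shows "jacobi_action (M, X, \<kappa>) (\<tau>, z) \<in> siegel_jacobi"
    and "eta1 (jacobi_action (M, X, \<kappa>) (\<tau>, z)) = Im (u * cnj w) / (2 * Im \<tau>)"
    and "eta2 (jacobi_action (M, X, \<kappa>) (\<tau>, z)) =
      (Im (u * cnj w) / (2 * Im \<tau>))\<^sup>2 + (cmod w)\<^sup>2 / (2 * Im \<tau>)"
proof -
  have "w \<noteq> 0"
  proof
    assume w: "w = 0"
    then have "M $ 2 $ 1 * Im \<tau> = 0" by (simp add: w_def complex_eq_iff)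
    then have "M $ 2 $ 1 = 0" using assms(2) by simp
    moreover from this w have "M $ 2 $ 2 = 0" by (simp add: w_def)
    ultimately show False using assms(1) by (simp add: det_2)
  qed
  then have w: "0 < (cmod w)\<^sup>2" by simp
  note theta = theta_jacobi_action[OF assms(1), of X \<kappa> \<tau> z, folded w_def u_def]
  have "theta2 (jacobi_action (M, X, \<kappa>) (\<tau>, z)) < 0"
    unfolding theta using w assms(2) by (simp add: divide_less_0_iff)
  then show "jacobi_action (M, X, \<kappa>) (\<tau>, z) \<in> siegel_jacobi"
    by (simp add: theta2_def siegel_jacobi_def split_beta)
  show "eta1 (jacobi_action (M, X, \<kappa>) (\<tau>, z)) = Im (u * cnj w) / (2 * Im \<tau>)"
    unfolding eta1_def theta using w assms(2) by (simp add: field_simps del: times_complex.sel)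
  show "eta2 (jacobi_action (M, X, \<kappa>) (\<tau>, z)) =
      (Im (u * cnj w) / (2 * Im \<tau>))\<^sup>2 + (cmod w)\<^sup>2 / (2 * Im \<tau>)"
    unfolding eta2_def theta using w assms(2)
    by (simp add: field_simps power2_eq_square del: times_complex.sel)
qed

text \<open>Equivariance on the span of F, Q, R, verified in coordinates: both sides become
  polynomials in the real parameters introduced below.\<close>

lemma momentum_Ad_of_quadratic:
  assumes g: "g \<in> carrier jacobi_group" and p: "p \<in> siegel_jacobi"
  defines "q \<equiv> jacobi_action (inv\<^bsub>jacobi_group\<^esub> g) p"
  shows "q \<in> siegel_jacobi"
    and "momentum (Ad g (of_quadratic [:\<gamma>, \<beta>, \<alpha>:])) p
      = momentum (of_quadratic [:\<gamma>, \<beta>, \<alpha>:]) q"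
proof -
  obtain M X \<kappa> where g': "g = (M, X, \<kappa>)" by (cases g)
  obtain \<tau> z where p': "p = (\<tau>, z)" by (cases p)
  define a b c d where abcd: "a = M $ 1 $ 1" "b = M $ 1 $ 2" "c = M $ 2 $ 1" "d = M $ 2 $ 2"
  define l m where lm: "l = X $ 1" "m = X $ 2"
  define x y where xy: "x = Re \<tau>" "y = Im \<tau>"
  define u v where uv: "u = Re z" "v = Im z"
  note vars = abcd[symmetric] lm[symmetric] xy[symmetric] uv[symmetric]
  have y: "0 < y" using p by (simp add: p' siegel_jacobi_def xy)
  have ad: "a * d = 1 + b * c"
    using g by (simp add: g' jacobi_group_def det_2 abcd)
  have det: "det (sl2_inv M) = 1"
    using ad by (simp add: det_2 sl2_inv_def abcd algebra_simps)
  have inv: "inv\<^bsub>jacobi_group\<^esub> g = (sl2_inv M, - X v* sl2_inv M, - \<kappa>)"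
    using g inv_jacobi_group by (simp add: g')
  have Im\<tau>: "0 < Im \<tau>" using y xy by simp
  note eta = eta_jacobi_action[OF det Im\<tau>, of "- X v* sl2_inv M" "- \<kappa>" z, folded inv p', folded q_def]
  show "q \<in> siegel_jacobi" by (rule eta(1))
  define s where "s = v * (a - c * x) + u * c * y - l * y"
  \<comment> \<open>With w = a - c \<tau>, the first factor is z - l (d \<tau> - b) - m w. The
    product m |w|^2 is real, so \<open>m\<close> drops out, and Im ((d \<tau> - b)
    \<open>cnj\<close> w) = (a d - b c) y.\<close>
  have "Im ((z + of_real ((- X v* sl2_inv M) $ 1) * \<tau> + of_real ((- X v* sl2_inv M) $ 2)) *
      cnj (of_real (sl2_inv M $ 2 $ 1) * \<tau> + of_real (sl2_inv M $ 2 $ 2)))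
    = v * (a - c * x) + u * c * y - l * y * (a * d - b * c)"
    by (simp add: sl2_inv_def vector_matrix_mult_def sum_2 vars) (simp add: algebra_simps)
  then have s: "Im ((z + of_real ((- X v* sl2_inv M) $ 1) * \<tau> + of_real ((- X v* sl2_inv M) $ 2)) *
      cnj (of_real (sl2_inv M $ 2 $ 1) * \<tau> + of_real (sl2_inv M $ 2 $ 2))) = s"
    using ad by (simp add: s_def)
  have w: "(cmod (of_real (sl2_inv M $ 2 $ 1) * \<tau> + of_real (sl2_inv M $ 2 $ 2)))\<^sup>2
      = (a - c * x)\<^sup>2 + (c * y)\<^sup>2"
    by (simp add: cmod_power2 sl2_inv_def vars)
  \<comment> \<open>\<open>h\<close> and \<open>r\<close> are the mean and variance of the Gaussian
    density attached to \<open>p\<close>, and \<open>n\<close> is the mean of the one attached to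
    \<open>q\<close>; using them removes the denominators in \<open>y\<close>.\<close>
  define h r where hr: "h = v / (2 * y)" "r = 1 / (2 * y)"
  define n where n: "n = h * (a - c * x) + u * c / 2 - l / 2"
  have "s / (2 * y) = n"
    using y by (simp add: s_def n hr field_simps)
  moreover have "((a - c * x)\<^sup>2 + (c * y)\<^sup>2) / (2 * y) = (a - c * x)\<^sup>2 * r + c\<^sup>2 * y / 2"
    using y by (simp add: hr field_simps power2_eq_square)
  ultimately have q: "eta1 q = n" "eta2 q = n\<^sup>2 + (a - c * x)\<^sup>2 * r + c\<^sup>2 * y / 2"
    unfolding eta s w vars by simp_all
  have e: "eta1 p = h" "eta2 p = h\<^sup>2 + r" and th: "dtheta1 p = - u" "dtheta2 p = x"
    using y by (simp_all add: eta1_def eta2_def theta1_def theta2_def dtheta1_def dtheta2_def p'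
        vars hr field_simps power2_eq_square)
  \<comment> \<open>Here \<eta>1^2 - \<eta>2 = -r, so the fractional term of
    \<open>momentum_G\<close> is 1 / (4 r) = y / 2.\<close>
  have G: "momentum_G p = u\<^sup>2 / 4 + (h\<^sup>2 + r) * x\<^sup>2 - h * u * x + y / 2"
    using y unfolding momentum_G_def e th by (simp add: hr)
  have k: "of_quadratic [:\<gamma>, \<beta>, \<alpha>:]
      = (vector [vector [0, - \<alpha>], vector [0, 0]], vector [0, \<beta>], - 4 * \<gamma>)"
    by (simp add: of_quadratic_def elt_F_def elt_Q_def elt_R_def vec_eq_iff forall_2 numeral_2_eq_2)
  \<comment> \<open>Conjugating F by \<open>M\<close> gives the column (a, c) times the row (-c, a),
    and X F = (0, l); hence \<open>b\<close>, \<open>d\<close> and \<open>m\<close> do not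
    occur.\<close>
  have "momentum (Ad g (of_quadratic [:\<gamma>, \<beta>, \<alpha>:])) p
    = \<alpha> * (a\<^sup>2 * eta2 p + c\<^sup>2 * momentum_G p + a * c * momentum_H p)
      - (\<beta> - \<alpha> * l) * (c * momentum_P p - a * eta1 p) + \<gamma> - l * \<beta> / 2 + \<alpha> * l\<^sup>2 / 4"
    unfolding k g' using g[unfolded g']
    by (simp add: Ad_eq vector_matrix_mult_def matrix_matrix_mult_def sum_2 sl2_inv_def
        symp_form_def momentum_F_def momentum_Q_def momentum_R_def vars)
      (simp add: field_simps power2_eq_square)
  \<comment> \<open>Since \<open>momentum_P p\<close> = h x - u / 2, one has n = a h - c *
    \<open>momentum_P p\<close> - l / 2. The terms in \<open>l\<close> therefore complete the square
    n^2 in the coefficient of \<open>\<alpha>\<close> and give n in that of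
    \<open>\<beta>\<close>.\<close>
  also have "\<dots> = \<alpha> * eta2 q + \<beta> * eta1 q + \<gamma>"
    unfolding G momentum_H_def momentum_P_def e th q n
    by (simp add: field_simps power2_eq_square)
  finally show "momentum (Ad g (of_quadratic [:\<gamma>, \<beta>, \<alpha>:])) p
      = momentum (of_quadratic [:\<gamma>, \<beta>, \<alpha>:]) q"
    by (simp only: momentum_of_quadratic)
qed

theorem proposition3p54:
  fixes f :: "complex \<times> complex \<Rightarrow> real"
    and g :: jacobi_ambient
    and \<alpha> \<beta> \<gamma> :: real
  assumes "g \<in> carrier jacobi_group"
    and "kaehler_function f"
    and "\<forall>p\<in>siegel_jacobi. f p = momentum (Ad g (of_quadratic [:\<gamma>, \<beta>, \<alpha>:])) p"
  shows "\<forall>p\<in>siegel_jacobi.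
    has_bochner_integral lborel
      (\<lambda>x. (\<alpha> * x\<^sup>2 + \<beta> * x + \<gamma>)
        * (gaussian_proj \<circ> jacobi_action (inv\<^bsub>jacobi_group\<^esub> g)) p x)
      (f p)"
proof
  fix p assume p: "p \<in> siegel_jacobi"
  show "has_bochner_integral lborel
      (\<lambda>x. (\<alpha> * x\<^sup>2 + \<beta> * x + \<gamma>)
        * (gaussian_proj \<circ> jacobi_action (inv\<^bsub>jacobi_group\<^esub> g)) p x) (f p)"
    using has_bochner_integral_gaussian_proj momentum_Ad_of_quadratic[OF assms(1) p]
      momentum_of_quadratic assms(3) p
    by simp
qed

end
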